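(* There exist a non-singular unimodular lattice $x$ in $\mathbb{R}^2$ and a nonempty open bounded set $\mathcal{O}\subset\mathbb{R}^2$ such that $$\dim_H F_{S^+(\mathcal{O})}(x)=2.$$
   Context: Here $d=2$ and $a_t=\mathrm{diag}(e^t,e^{-t})$. $X\simeq\mathrm{SL}_2(\mathbb{R})/\mathrm{SL}_2(\mathbb{Z})$ is the space of unimodular (covolume 1) lattices in $\mathbb{R}^2$. A lattice $x\in X$ is non-singular if its forward orbit $(a_tx)_{t>0}$ is non-divergent in $X$ (i.e. it is not the case that $a_tx$ eventually leaves every compact subset of $X$ as $t\to+\infty$). For a bounded open $\mathcal{O}\subset\mathbb{R}^2$ let $S^+(\mathcal{O})=\bigcup_{t>0}a_t^{-1}\mathcal{O}$. For $x\in X$, $\pi^{-1}(x)=\{x+w:w\in\mathbb{R}^2\}\simeq\mathbb{R}^2/x$ is the torus of all grids (translates) of $x$, and $F_{S^+(\mathcal{O})}(x)=\{y\in\pi^{-1}(x):y\cap S^+(\mathcal{O})\text{ is finite}\}$. $\dim_H$ is Hausdorff dimension with respect to the Euclidean metric on $\mathbb{R}^2/x$. *)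

theory Defs
  imports "HOL-Analysis.Analysis"
begin

section \<open>Hausdorff dimension\<close>

text \<open>
  The metric is an arbitrary function \<open>d\<close> on a carrier \<open>M\<close>, as in the locale
  \<^locale>\<open>Metric_space\<close>, because it will be applied to a torus whose points are sets.
\<close>

text \<open>As for \<^const>\<open>diameter\<close>, the value is meaningful only for bounded sets.\<close>

definition mdiameter :: "('a \<Rightarrow> 'a \<Rightarrow> real) \<Rightarrow> 'a set \<Rightarrow> real" where
  "mdiameter d S = (if S = {} then 0 else SUP (x, y) \<in> S \<times> S. d x y)"

text \<open>
  The weight \<open>diam(S)\<^sup>s\<close>, with the conventions that the empty set has weight \<open>0\<close>
  and \<open>0\<^sup>0 = 1\<close> for nonempty sets (whereas \<open>0 powr 0 = 0\<close>).
\<close>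

definition diam_power :: "('a \<Rightarrow> 'a \<Rightarrow> real) \<Rightarrow> real \<Rightarrow> 'a set \<Rightarrow> ennreal" where
  "diam_power d s S =
     (if S = {} then 0 else if s = 0 then 1 else ennreal (mdiameter d S powr s))"

definition delta_covers ::
    "'a set \<Rightarrow> ('a \<Rightarrow> 'a \<Rightarrow> real) \<Rightarrow> real \<Rightarrow> 'a set \<Rightarrow> (nat \<Rightarrow> 'a set) set" where
  "delta_covers M d \<delta> A =
     {U. A \<subseteq> (\<Union>i. U i) \<and> (\<forall>i. U i \<subseteq> M \<and> (\<forall>x\<in>U i. \<forall>y\<in>U i. d x y \<le> \<delta>))}"

definition hausdorff_measure ::
    "'a set \<Rightarrow> ('a \<Rightarrow> 'a \<Rightarrow> real) \<Rightarrow> real \<Rightarrow> 'a set \<Rightarrow> ennreal" where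
  "hausdorff_measure M d s A =
     (SUP \<delta>\<in>{0<..}. INF U\<in>delta_covers M d \<delta> A. \<Sum>i. diam_power d s (U i))"

definition hausdorff_dim :: "'a set \<Rightarrow> ('a \<Rightarrow> 'a \<Rightarrow> real) \<Rightarrow> 'a set \<Rightarrow> ereal" where
  "hausdorff_dim M d A = (INF s\<in>{s. 0 \<le> s \<and> hausdorff_measure M d s A = 0}. ereal s)"

section \<open>The space of unimodular lattices in the plane\<close>

definition SL2R :: "(real^2^2) set" where
  "SL2R = {g. det g = 1}"

definition lattice_of :: "real^2^2 \<Rightarrow> (real^2) set" where
  "lattice_of g = (*v) g ` {v. \<forall>i. v $ i \<in> \<int>}"

definition unimodular_lattices :: "(real^2) set set" where
  "unimodular_lattices = lattice_of ` SL2R"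

text \<open>
  Two matrices in \<^const>\<open>SL2R\<close> span the same lattice iff they differ by an element of
  \<open>SL\<^sub>2(\<int>)\<close> on the right, so the topology of \<open>SL\<^sub>2(\<real>)/SL\<^sub>2(\<int>)\<close> is the
  quotient topology under \<^const>\<open>lattice_of\<close>.
\<close>

definition lattice_space :: "(real^2) set topology" where
  "lattice_space = topology (\<lambda>U. U \<subseteq> unimodular_lattices \<and>
     openin (top_of_set SL2R) {g \<in> SL2R. lattice_of g \<in> U})"

definition diag_flow :: "real \<Rightarrow> real^2^2" where
  "diag_flow t = vector [vector [exp t, 0], vector [0, exp (- t)]]"

definition divergent_orbit :: "(real^2) set \<Rightarrow> bool" where
  "divergent_orbit x \<longleftrightarrow>
     (\<forall>K. compactin lattice_space K \<longrightarrow> (\<forall>\<^sub>F t in at_top. (*v) (diag_flow t) ` x \<notin> K))"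

definition nonsingular_lattice :: "(real^2) set \<Rightarrow> bool" where
  "nonsingular_lattice x \<longleftrightarrow> x \<in> unimodular_lattices \<and> \<not> divergent_orbit x"

section \<open>Grids\<close>

text \<open>
  The torus \<open>\<real>\<^sup>2/x\<close> is the set of translates of \<open>x\<close>; its flat metric is
  \<^const>\<open>setdist\<close>, the infimum of the distances between representatives.
\<close>

definition grids :: "(real^2) set \<Rightarrow> (real^2) set set" where
  "grids x = range (\<lambda>w. (+) w ` x)"

definition S_plus :: "(real^2) set \<Rightarrow> (real^2) set" where
  "S_plus V = (\<Union>t\<in>{0<..}. (*v) (diag_flow t) -` V)"

definition finite_grids :: "(real^2) set \<Rightarrow> (real^2) set \<Rightarrow> (real^2) set set" where
  "finite_grids S x = {y \<in> grids x. finite (y \<inter> S)}"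

section \<open>Consistency of the definitions\<close>

lemma istopology_lattice_space:
  "istopology (\<lambda>U. U \<subseteq> unimodular_lattices \<and>
     openin (top_of_set SL2R) {g \<in> SL2R. lattice_of g \<in> U})"
proof -
  have *: "{g \<in> SL2R. lattice_of g \<in> S \<inter> T} =
      {g \<in> SL2R. lattice_of g \<in> S} \<inter> {g \<in> SL2R. lattice_of g \<in> T}" for S T
    by blast
  have **: "{g \<in> SL2R. lattice_of g \<in> \<Union>\<K>} = (\<Union>U\<in>\<K>. {g \<in> SL2R. lattice_of g \<in> U})" for \<K>
    by blast
  show ?thesis
    unfolding istopology_def * ** by (auto intro!: openin_Union openin_Int)
qed

lemma openin_lattice_space:
  "openin lattice_space U \<longleftrightarrow>
     U \<subseteq> unimodular_lattices \<and> openin (top_of_set SL2R) {g \<in> SL2R. lattice_of g \<in> U}"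
  unfolding lattice_space_def by (simp add: topology_inverse'[OF istopology_lattice_space])

lemma topspace_lattice_space: "topspace lattice_space = unimodular_lattices"
proof -
  have "{g \<in> SL2R. lattice_of g \<in> unimodular_lattices} = SL2R"
    by (auto simp: unimodular_lattices_def)
  then have "openin lattice_space unimodular_lattices"
    by (simp add: openin_lattice_space)
  then show ?thesis
    by (metis openin_lattice_space openin_subset openin_topspace subset_antisym)
qed

lemma quotient_map_lattice_of: "quotient_map (top_of_set SL2R) lattice_space lattice_of"
  by (auto simp: quotient_map_def topspace_lattice_space openin_lattice_space
      unimodular_lattices_def)

text \<open>Restricting to positively oriented bases loses no lattice of covolume 1.\<close>

lemma unimodular_lattices_iff:
  "x \<in> unimodular_lattices \<longleftrightarrow> (\<exists>g. \<bar>det g\<bar> = 1 \<and> x = lattice_of g)"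
proof
  assume "x \<in> unimodular_lattices"
  then show "\<exists>g. \<bar>det g\<bar> = 1 \<and> x = lattice_of g"
    by (force simp: unimodular_lattices_def SL2R_def)
next
  assume "\<exists>g. \<bar>det g\<bar> = 1 \<and> x = lattice_of g"
  then obtain g where g: "\<bar>det g\<bar> = 1" "x = lattice_of g" by blast
  define n :: "real^2^2" where "n = vector [vector [1, 0], vector [0, -1]]"
  let ?Z = "{v::real^2. \<forall>i. v $ i \<in> \<int>}"
  have nv: "n *v v = vector [v $ 1, - v $ 2]" for v
    by (simp add: n_def vec_eq_iff forall_2 matrix_vector_mult_def sum_2)
  have sub: "(*v) n ` ?Z \<subseteq> ?Z"
    by (auto simp: nv forall_2)
  have inv: "n *v (n *v v) = v" for v
    by (simp add: nv vec_eq_iff forall_2)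
  have "?Z \<subseteq> (*v) n ` ?Z"
  proof
    fix v assume "v \<in> ?Z"
    then have "n *v v \<in> ?Z" using sub by blast
    then show "v \<in> (*v) n ` ?Z" using inv by (metis image_eqI)
  qed
  with sub have "(*v) n ` ?Z = ?Z" by blast
  then have "lattice_of (g ** n) = lattice_of g"
    unfolding lattice_of_def by (metis (no_types, lifting) image_cong image_image matrix_vector_mul_assoc)
  moreover have "det (g ** n) = - det g"
    by (simp add: det_mul) (simp add: det_2 n_def)
  ultimately show "x \<in> unimodular_lattices"
    using g unfolding unimodular_lattices_def SL2R_def
    by (cases "det g = 1") (auto intro!: image_eqI[where x = g] image_eqI[where x = "g ** n"])
qed

lemma closed_lattice_of:
  assumes "det g \<noteq> 0"
  shows "closed (lattice_of g)"
proof -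
  have "closed {v::real^2. \<forall>i. v $ i \<in> \<int>}"
  proof -
    have "{v::real^2. \<forall>i. v $ i \<in> \<int>} = (\<Inter>i. (\<lambda>v. v $ i) -` \<int>)"
      by auto
    then show ?thesis
      by (auto intro!: closed_INT closed_vimage closed_Ints continuous_intros)
  qed
  moreover have "inj ((*v) g)"
    using assms by (simp add: inj_matrix_vector_mult invertible_det_nz)
  ultimately show ?thesis
    unfolding lattice_of_def by (intro closed_injective_linear_image) auto
qed

lemma lattice_of_add_image:
  assumes "w \<in> lattice_of g"
  shows "(+) w ` lattice_of g = lattice_of g"
proof -
  have diff: "a - b \<in> lattice_of g" if "a \<in> lattice_of g" "b \<in> lattice_of g" for a b
    using that unfolding lattice_of_def
    by (auto simp flip: matrix_vector_mult_diff_distrib intro!: imageI)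
  have "- w \<in> lattice_of g" using diff[OF diff[OF assms assms] assms] by simp
  then have add: "w + a \<in> lattice_of g" if "a \<in> lattice_of g" for a
    using diff[OF that] by (metis add.commute diff_minus_eq_add)
  show ?thesis
  proof
    show "(+) w ` lattice_of g \<subseteq> lattice_of g" using add by blast
    show "lattice_of g \<subseteq> (+) w ` lattice_of g"
    proof
      fix a assume "a \<in> lattice_of g"
      then have "a - w \<in> lattice_of g" using diff assms by blast
      then show "a \<in> (+) w ` lattice_of g" by (metis diff_add_cancel add.commute image_eqI)
    qed
  qed
qed

lemma Metric_space_grids:
  assumes "x \<in> unimodular_lattices"
  shows "Metric_space (grids x) setdist"
proof -
  obtain g where g: "det g = 1" and x: "x = lattice_of g"
    using assms by (auto simp: unimodular_lattices_def SL2R_def)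
  have ne: "x \<noteq> {}" by (auto simp: x lattice_of_def intro!: exI[where x = 0])
  have grid: "(+) a ` x = y" if "y \<in> grids x" "a \<in> y" for a y
  proof -
    obtain w v where "y = (+) w ` x" "v \<in> x" "a = w + v"
      using \<open>y \<in> grids x\<close> \<open>a \<in> y\<close> by (auto simp: grids_def)
    have "(+) a ` x = (+) w ` ((+) v ` x)"
      unfolding \<open>a = w + v\<close> image_image by (simp add: add.assoc)
    with \<open>v \<in> x\<close> \<open>y = _\<close> show ?thesis
      by (simp add: x lattice_of_add_image)
  qed
  have sd: "setdist {a} z = setdist y z" if "y \<in> grids x" "z \<in> grids x" "a \<in> y" for a y z
  proof (rule antisym)
    have ney: "y \<noteq> {}" and nez: "z \<noteq> {}" using that ne by (auto simp: grids_def)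
    show "setdist y z \<le> setdist {a} z" using that by (rule_tac setdist_le_sing)
    have "setdist {a} z \<le> dist b c" if "b \<in> y" "c \<in> z" for b c
    proof -
      have "b \<in> (+) a ` x" using grid[OF \<open>y \<in> grids x\<close> \<open>a \<in> y\<close>] \<open>b \<in> y\<close> by simp
      then obtain v where v: "v \<in> x" "b = a + v" by auto
      have "- v \<in> x"
      proof -
        have "0 \<in> lattice_of g" by (auto simp: lattice_of_def intro!: image_eqI[where x = 0])
        then have "0 \<in> (+) v ` lattice_of g"
          using lattice_of_add_image[of v g] v x by simp
        then obtain u where "u \<in> lattice_of g" "0 = v + u" by blast
        then show ?thesis by (metis x add_eq_0_iff)
      qed
      then have "c + - v \<in> z"
        using grid[OF \<open>z \<in> grids x\<close> \<open>c \<in> z\<close>] by blast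
      then have "setdist {a} z \<le> dist a (c + - v)" by (intro setdist_le_dist) auto
      also have "\<dots> = dist b c" by (simp add: v dist_norm algebra_simps)
      finally show ?thesis .
    qed
    then show "setdist {a} z \<le> setdist y z" using ney nez by (simp add: le_setdist_iff)
  qed
  show ?thesis
  proof
    fix y z :: "(real^2) set"
    show "0 \<le> setdist y z" by simp
    show "setdist y z = setdist z y" by (rule setdist_sym)
    assume yz: "y \<in> grids x" "z \<in> grids x"
    then obtain a where a: "a \<in> y" using ne by (auto simp: grids_def)
    have "closed z"
      using yz closed_lattice_of[of g] g x by (auto simp: grids_def closed_translation)
    moreover have "z \<noteq> {}" using yz ne by (auto simp: grids_def)
    ultimately have "setdist y z = 0 \<longleftrightarrow> a \<in> z"
      by (simp flip: sd[OF yz a] add: setdist_eq_0_sing_1)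
    also have "\<dots> \<longleftrightarrow> y = z" using grid yz a by metis
    finally show "setdist y z = 0 \<longleftrightarrow> y = z" .
  next
    fix y z u assume yzu: "y \<in> grids x" "z \<in> grids x" "u \<in> grids x"
    then obtain b where b: "b \<in> z" using ne by (auto simp: grids_def)
    show "setdist y u \<le> setdist y z + setdist z u"
      using setdist_triangle[of y u b] sd[OF yzu(2,3) b] sd[OF yzu(2,1) b]
      by (simp add: setdist_sym)
  qed
qed

end

theory Submission
  imports Defs
begin

text \<open>
  The lattice is \<open>x = {(m + n\<alpha>, n)}\<close> for a real \<open>\<alpha>\<close> with convergents \<open>p\<^sub>k/q\<^sub>k\<close> whose
  denominators satisfy \<open>q\<^sub>k\<^sub>+\<^sub>1/q\<^sub>k \<rightarrow> \<infinity>\<close>, and the open set is a box \<open>V\<close> around the vertical segment from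
  \<open>(0, 1)\<close> to \<open>(0, 2)\<close>. Every point \<open>(u, v)\<close> of \<open>S\<^sup>+(V)\<close> has \<open>v > 1\<close> and \<open>\<bar>uv\<bar>\<close> small. So a grid
  misses \<open>S\<^sup>+(V)\<close> altogether as soon as \<open>\<bar>uv\<bar>\<close> is bounded below by a fixed constant on its points
  with \<open>v > 1\<close>; for the translate of \<open>x\<close> by \<open>(a, b)\<close> this says that \<open>a\<close> is badly approximable by
  the numbers \<open>- n\<alpha> - m\<close>.

  It is enough that \<open>q\<^sub>k a\<close> has fractional part in \<open>[1/3, 2/3]\<close> for every \<open>k\<close>, and \<open>b\<close> may then
  vary freely in \<open>[0, 1/3]\<close>. Indeed \<open>q\<^sub>k\<alpha>\<close> is within \<open>2/q\<^sub>k\<^sub>+\<^sub>1\<close> of the integer \<open>p\<^sub>k\<close>, so for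
  \<open>u = a + m + n\<alpha>\<close> with \<open>n\<close> at most a small multiple of \<open>q\<^sub>k\<^sub>+\<^sub>1\<close> the number \<open>q\<^sub>k u\<close> stays away
  from \<open>0\<close>; choosing \<open>k\<close> such that \<open>v\<close> is between \<open>q\<^sub>k/12\<close> and \<open>q\<^sub>k\<^sub>+\<^sub>1/12\<close> bounds
  \<open>\<bar>uv\<bar>\<close> below (\<open>grid_badly_approximable\<close>).

  The admissible \<open>a\<close> form a Cantor set: an admissible interval of length \<open>1/(3q\<^sub>k)\<close> contains about
  \<open>q\<^sub>k\<^sub>+\<^sub>1/(3q\<^sub>k)\<close> admissible intervals of the next level. Only a bounded proportion is lost at each
  level, and the numbers of children tend to infinity, so the dimension is \<open>1\<close>. To see this without
  constructing a measure, the digits of \<open>y \<in> [0, 1)\<close> in the factorial number system select the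
  children, and the inverse of the resulting map \<open>y \<mapsto> a\<close> is Hoelder continuous with every exponent
  below \<open>1\<close> (\<open>cell_point_inverse_Holder\<close>). With the free coordinate \<open>b\<close> this
  parametrises a family of good grids by a square, with an inverse that is Hoelder with every exponent below \<open>1\<close>, and
  the Lebesgue measure of the square forces dimension at least \<open>2\<close>
  (\<open>hausdorff_measure_nonzero_if_inverse_Holder\<close>). The torus itself has dimension at most \<open>2\<close>
  (\<open>hausdorff_measure_grids_eq_0\<close>).

  Finally \<open>x\<close> is non-singular: at the time \<open>t\<close> with \<open>exp t = q\<^sub>k\<^sub>+\<^sub>1\<close>, the two lattice vectors that
  come from the convergents \<open>k\<close> and \<open>k + 1\<close> form a basis of \<open>a\<^sub>t x\<close> with entries of size at most \<open>2\<close>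
  (\<open>nonsingular_lattice_of_convergents\<close>).
\<close>

section \<open>Bounds for the Hausdorff dimension\<close>

text \<open>
  \<^const>\<open>mdiameter\<close> is a supremum of reals and so dominates the distances only when these are
  bounded; in a \<open>\<delta>\<close>-cover they always are.
\<close>

lemma mdiameter_upper:
  assumes "\<And>x y. x \<in> S \<Longrightarrow> y \<in> S \<Longrightarrow> d x y \<le> b" and "x \<in> S" "y \<in> S"
  shows "d x y \<le> mdiameter d S"
proof -
  have "bdd_above ((\<lambda>(x, y). d x y) ` (S \<times> S))"
    using assms(1) by (auto intro!: bdd_aboveI[where M = b])
  then have "(\<lambda>(x, y). d x y) (x, y) \<le> (SUP (x, y)\<in>S \<times> S. d x y)"
    using assms(2,3) by (intro cSUP_upper) auto
  then show ?thesis using assms(2) by (auto simp: mdiameter_def)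
qed

lemma mdiameter_least:
  assumes "\<And>x y. x \<in> S \<Longrightarrow> y \<in> S \<Longrightarrow> d x y \<le> b" and "0 \<le> b"
  shows "mdiameter d S \<le> b"
proof (cases "S = {}")
  case False
  have "(\<lambda>(x, y). d x y) p \<le> b" if "p \<in> S \<times> S" for p
    using that assms(1) by auto
  then have "(SUP (x, y)\<in>S \<times> S. d x y) \<le> b"
    using False by (intro cSUP_least) auto
  then show ?thesis using False by (simp add: mdiameter_def)
qed (simp add: mdiameter_def assms)

lemma diam_power_antimono:
  assumes "0 \<le> s" "s \<le> t" "\<And>x y. 0 \<le> d x y"
    and "\<And>x y. x \<in> S \<Longrightarrow> y \<in> S \<Longrightarrow> d x y \<le> 1"
  shows "diam_power d t S \<le> diam_power d s S"
proof (cases "S = {}")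
  case False
  then obtain x where "x \<in> S" by blast
  then have "0 \<le> mdiameter d S"
    using mdiameter_upper[of S d 1 x x] assms(3)[of x x] assms(4) by force
  moreover have "mdiameter d S \<le> 1" using assms(4) by (intro mdiameter_least) auto
  moreover have "mdiameter d S powr t \<le> mdiameter d S powr s"
    using calculation assms(1,2) powr_mono'[of s t "mdiameter d S"] by (cases "mdiameter d S = 0") auto
  ultimately show ?thesis
    using False assms(1,2) by (auto simp: diam_power_def intro!: powr_le1 ennreal_leI)
qed (simp add: diam_power_def)

lemma hausdorff_measure_0_mono:
  assumes "hausdorff_measure M d s A = 0" "0 \<le> s" "s \<le> t" "\<And>x y. 0 \<le> d x y"
  shows "hausdorff_measure M d t A = 0"
proof -
  have "(INF U\<in>delta_covers M d \<delta> A. \<Sum>i. diam_power d t (U i)) = 0" if "0 < \<delta>" for \<delta>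
  proof -
    have "(INF U\<in>delta_covers M d \<delta> A. \<Sum>i. diam_power d t (U i))
        \<le> (INF U\<in>delta_covers M d (min \<delta> 1) A. \<Sum>i. diam_power d s (U i))"
    proof (rule INF_mono)
      fix U assume U: "U \<in> delta_covers M d (min \<delta> 1) A"
      then have "U \<in> delta_covers M d \<delta> A" by (auto simp: delta_covers_def)
      moreover have "(\<Sum>i. diam_power d t (U i)) \<le> (\<Sum>i. diam_power d s (U i))"
        using U assms by (intro suminf_le diam_power_antimono) (auto simp: delta_covers_def)
      ultimately show "\<exists>U'\<in>delta_covers M d \<delta> A.
          (\<Sum>i. diam_power d t (U' i)) \<le> (\<Sum>i. diam_power d s (U i))"
        by blast
    qed
    also have "\<dots> \<le> hausdorff_measure M d s A"
      unfolding hausdorff_measure_def using that by (intro SUP_upper) auto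
    finally show ?thesis using assms(1) by simp
  qed
  then show ?thesis by (auto simp: hausdorff_measure_def)
qed

text \<open>
  The weights obey their own convention for the exponent \<open>0\<close>; but if the measure vanished there, it
  would also vanish for a positive exponent below \<open>r\<close>.
\<close>

lemma hausdorff_dim_eqI:
  assumes "\<And>s. r < s \<Longrightarrow> hausdorff_measure M d s A = 0"
    and "\<And>s. 0 < s \<Longrightarrow> s < r \<Longrightarrow> hausdorff_measure M d s A \<noteq> 0"
    and "0 < r" "\<And>x y. 0 \<le> d x y"
  shows "hausdorff_dim M d A = ereal r"
  unfolding hausdorff_dim_def
proof (rule antisym)
  show "(INF s\<in>{s. 0 \<le> s \<and> hausdorff_measure M d s A = 0}. ereal s) \<le> ereal r"
  proof (rule ereal_le_epsilon2)
    fix e :: real assume "0 < e"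
    then show "(INF s\<in>{s. 0 \<le> s \<and> hausdorff_measure M d s A = 0}. ereal s) \<le> ereal r + ereal e"
      using assms(1)[of "r + e"] assms(3) by (auto intro!: INF_lower2[where i = "r + e"])
  qed
  show "ereal r \<le> (INF s\<in>{s. 0 \<le> s \<and> hausdorff_measure M d s A = 0}. ereal s)"
  proof (rule INF_greatest)
    fix s assume s: "s \<in> {s. 0 \<le> s \<and> hausdorff_measure M d s A = 0}"
    show "ereal r \<le> ereal s"
    proof (rule ccontr)
      assume "\<not> ereal r \<le> ereal s"
      then have "0 < (s + r) / 2" "(s + r) / 2 < r" "s \<le> (s + r) / 2" using s by auto
      moreover from this have "hausdorff_measure M d ((s + r) / 2) A = 0"
        using s assms(4) hausdorff_measure_0_mono[of M d s A "(s + r) / 2"] by simp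
      ultimately show False using assms(2) by blast
    qed
  qed
qed

lemma emeasure_lborel_prod_cbox:
  assumes "a \<le> b" "c \<le> d"
  shows "emeasure lborel (cbox (a, c) (b, d) :: (real \<times> real) set) = ennreal ((b - a) * (d - c))"
proof -
  have "emeasure (lborel \<Otimes>\<^sub>M lborel) ({a..b} \<times> {c..d}) = ennreal ((b - a) * (d - c))"
    using assms by (subst lborel.emeasure_pair_measure_Times) (simp_all add: ennreal_mult')
  then show ?thesis by (simp add: lborel_prod cbox_Pair_eq)
qed

text \<open>
  This replaces the mass distribution principle: a cover of \<open>A\<close> by sets of diameter \<open>D\<close> pulls back
  under \<open>\<phi>\<close> to a cover of the unit square by sets of diameter at most \<open>C D\<^sup>s\<^sup>/\<^sup>2\<close>. These lie in squares of
  area \<open>4 C\<^sup>2 D\<^sup>s\<close>, and the areas must add up to at least \<open>1\<close>.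
\<close>

lemma hausdorff_measure_nonzero_if_inverse_Holder:
  fixes \<phi> :: "real \<times> real \<Rightarrow> 'a"
  assumes "\<And>p. p \<in> box (0, 0) (1, 1) \<Longrightarrow> \<phi> p \<in> A"
    and "\<And>p p'. p \<in> box (0, 0) (1, 1) \<Longrightarrow> p' \<in> box (0, 0) (1, 1) \<Longrightarrow>
           dist p p' \<le> C * d (\<phi> p) (\<phi> p') powr (s / 2)"
    and "0 < s" "0 \<le> C" and d: "\<And>x y. 0 \<le> d x y"
  shows "hausdorff_measure M d s A \<noteq> 0"
proof
  assume H0: "hausdorff_measure M d s A = 0"
  let ?B = "box (0, 0) (1, 1) :: (real \<times> real) set"
  have lower: "1 \<le> ennreal (4 * C\<^sup>2) * (\<Sum>i. diam_power d s (U i))"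
    if U: "U \<in> delta_covers M d 1 A" for U
  proof -
    define Y where "Y i = {p \<in> ?B. \<phi> p \<in> U i}" for i
    \<comment> \<open>The sets \<open>Y i\<close> need not be measurable, so they are enclosed in squares \<open>Z i\<close>.\<close>
    define Z where "Z i = (if Y i = {} then {} else
      (let p = (SOME p. p \<in> Y i); R = C * mdiameter d (U i) powr (s / 2)
       in cbox (p - (R, R)) (p + (R, R))))" for i
    have Z: "Y i \<subseteq> Z i \<and> Z i \<in> sets lborel \<and>
        emeasure lborel (Z i) \<le> ennreal (4 * C\<^sup>2) * diam_power d s (U i)" for i
    proof (cases "Y i = {}")
      case False
      define p where "p = (SOME p. p \<in> Y i)"
      define R where "R = C * mdiameter d (U i) powr (s / 2)"
      have Zi: "Z i = cbox (p - (R, R)) (p + (R, R))"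
        using False by (simp add: Z_def p_def R_def Let_def)
      have p: "p \<in> Y i" using False unfolding p_def by (simp add: some_in_eq)
      have U1: "x \<in> U i \<Longrightarrow> y \<in> U i \<Longrightarrow> d x y \<le> 1" for x y
        using U by (auto simp: delta_covers_def)
      have "Y i \<subseteq> Z i"
      proof
        fix p' assume p': "p' \<in> Y i"
        have "dist p p' \<le> C * d (\<phi> p) (\<phi> p') powr (s / 2)"
          using p p' assms(2) by (auto simp: Y_def)
        also have "\<dots> \<le> R"
          unfolding R_def using p p' assms(3,4) d mdiameter_upper[of "U i" d 1, OF U1]
          by (intro mult_left_mono powr_mono2) (auto simp: Y_def)
        finally have "dist p p' \<le> R" .
        then have "dist (fst p) (fst p') \<le> R" "dist (snd p) (snd p') \<le> R"
          using dist_fst_le dist_snd_le order_trans by blast+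
        then show "p' \<in> Z i"
          unfolding Zi by (cases p; cases p') (auto simp: dist_real_def)
      qed
      moreover have "emeasure lborel (Z i) = ennreal (4 * C\<^sup>2) * diam_power d s (U i)"
      proof -
        have "0 \<le> R" using assms(4) by (simp add: R_def)
        have ne: "U i \<noteq> {}" using p by (auto simp: Y_def)
        have "R * R = C\<^sup>2 * mdiameter d (U i) powr s"
          by (simp add: R_def power2_eq_square mult.assoc mult.left_commute flip: powr_add)
        moreover have "emeasure lborel (Z i) = ennreal ((2 * R) * (2 * R))"
          unfolding Zi using \<open>0 \<le> R\<close>
          by (cases p) (simp add: emeasure_lborel_prod_cbox)
        ultimately show ?thesis
          using ne assms(3) by (simp add: diam_power_def ennreal_mult' mult.assoc)
      qed
      ultimately show ?thesis unfolding Zi by simp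
    qed (auto simp: Z_def)
    have "1 = emeasure lborel ?B"
    proof -
      have "emeasure (lborel \<Otimes>\<^sub>M lborel) ({0<..<1::real} \<times> {0<..<1::real}) = 1"
        by (subst lborel.emeasure_pair_measure_Times) simp_all
      then show ?thesis by (simp add: lborel_prod box_prod)
    qed
    also have "?B \<subseteq> (\<Union>i. Z i)"
    proof
      fix p assume "p \<in> ?B"
      moreover have "A \<subseteq> (\<Union>i. U i)" using U by (auto simp: delta_covers_def)
      then have "\<phi> p \<in> (\<Union>i. U i)" using assms(1)[OF \<open>p \<in> ?B\<close>] by blast
      ultimately show "p \<in> (\<Union>i. Z i)" using Z by (auto simp: Y_def)
    qed
    then have "emeasure lborel ?B \<le> emeasure lborel (\<Union>i. Z i)"
      using Z by (intro emeasure_mono) auto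
    also have "\<dots> \<le> (\<Sum>i. emeasure lborel (Z i))"
      using Z by (intro emeasure_subadditive_countably) auto
    also have "\<dots> \<le> (\<Sum>i. ennreal (4 * C\<^sup>2) * diam_power d s (U i))"
      using Z by (intro suminf_le) auto
    finally show ?thesis by simp
  qed
  have "(INF U\<in>delta_covers M d 1 A. \<Sum>i. diam_power d s (U i)) \<le> hausdorff_measure M d s A"
    unfolding hausdorff_measure_def by (intro SUP_upper) auto
  also have "\<dots> < ennreal (1 / (4 * C\<^sup>2 + 1))" using H0 by (simp add: add_nonneg_pos)
  finally obtain U where U: "U \<in> delta_covers M d 1 A"
    and small: "(\<Sum>i. diam_power d s (U i)) < ennreal (1 / (4 * C\<^sup>2 + 1))"
    by (auto simp: INF_less_iff)
  have "1 \<le> ennreal (4 * C\<^sup>2) * (\<Sum>i. diam_power d s (U i))" using lower[OF U] .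
  also have "\<dots> \<le> ennreal (4 * C\<^sup>2) * ennreal (1 / (4 * C\<^sup>2 + 1))"
    using small by (intro mult_left_mono) auto
  also have "\<dots> = ennreal (4 * C\<^sup>2 / (4 * C\<^sup>2 + 1))"
    by (simp flip: ennreal_mult')
  also have "\<dots> < 1"
    by (simp add: ennreal_less_one_iff add_nonneg_pos)
  finally show False by simp
qed

section \<open>The lattices spanned by (1, 0) and (\<alpha>, 1)\<close>

definition shear :: "real \<Rightarrow> real^2^2" where
  "shear \<alpha> = vector [vector [1, \<alpha>], vector [0, 1]]"

lemma det_shear: "det (shear \<alpha>) = 1"
  by (simp add: det_2 shear_def)

lemma shear_mult: "shear \<alpha> *v v = vector [v $ 1 + v $ 2 * \<alpha>, v $ 2]"
  by (simp add: shear_def vec_eq_iff forall_2 matrix_vector_mult_def sum_2)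

lemma lattice_of_shear:
  "lattice_of (shear \<alpha>) = range (\<lambda>(m, n). vector [of_int m + of_int n * \<alpha>, of_int n])"
  (is "_ = range ?f")
proof
  show "lattice_of (shear \<alpha>) \<subseteq> range ?f"
    unfolding lattice_of_def
  proof clarify
    fix v :: "real^2" assume "\<forall>i. v $ i \<in> \<int>"
    then obtain m n where "v $ 1 = of_int m" "v $ 2 = of_int n"
      by (metis Ints_cases)
    then show "shear \<alpha> *v v \<in> range ?f"
      by (intro range_eqI[where x = "(m, n)"]) (simp add: shear_mult)
  qed
  show "range ?f \<subseteq> lattice_of (shear \<alpha>)"
  proof clarify
    fix m n :: int
    show "vector [of_int m + of_int n * \<alpha>, of_int n] \<in> lattice_of (shear \<alpha>)"
      unfolding lattice_of_def
      by (rule image_eqI[where x = "vector [of_int m, of_int n]"]) (auto simp: shear_mult forall_2)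
  qed
qed

lemma lattice_of_shear_unimodular: "lattice_of (shear \<alpha>) \<in> unimodular_lattices"
  by (simp add: unimodular_lattices_def SL2R_def det_shear)

text \<open>The matrix \<open>M\<close> permutes the integer vectors, so both sides are the same lattice in two bases.\<close>

lemma lattice_of_mult_integral:
  assumes "\<And>i j. M $ i $ j \<in> \<int>" "\<And>i j. M' $ i $ j \<in> \<int>" "M ** M' = mat 1"
  shows "lattice_of (g ** M) = lattice_of g"
proof -
  let ?Z = "{v::real^2. \<forall>i. v $ i \<in> \<int>}"
  have int: "N *v v \<in> ?Z" if "\<And>i j. N $ i $ j \<in> \<int>" "v \<in> ?Z" for N :: "real^2^2" and v
    using that by (auto simp: matrix_vector_mult_def intro!: Ints_mult Ints_add)
  have "(*v) M ` ?Z = ?Z"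
  proof
    show "(*v) M ` ?Z \<subseteq> ?Z" using int assms(1) by blast
    show "?Z \<subseteq> (*v) M ` ?Z"
    proof
      fix v assume "v \<in> ?Z"
      then have "M' *v v \<in> ?Z" using int assms(2) by blast
      moreover have "v = M *v (M' *v v)" by (simp add: matrix_vector_mul_assoc assms(3))
      ultimately show "v \<in> (*v) M ` ?Z" by blast
    qed
  qed
  then show ?thesis
    unfolding lattice_of_def
    by (metis (no_types, lifting) image_cong image_image matrix_vector_mul_assoc)
qed

definition grid :: "real \<Rightarrow> real \<Rightarrow> real \<Rightarrow> (real^2) set" where
  "grid \<alpha> a b = (+) (vector [a, b]) ` lattice_of (shear \<alpha>)"

lemma grid_in_grids: "grid \<alpha> a b \<in> grids (lattice_of (shear \<alpha>))"
  by (auto simp: grid_def grids_def)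

lemma mem_grid_iff:
  "v \<in> grid \<alpha> a b \<longleftrightarrow> (\<exists>m n. v $ 1 = a + (of_int m + of_int n * \<alpha>) \<and> v $ 2 = b + of_int n)"
  by (auto simp: grid_def lattice_of_shear vec_eq_iff forall_2 image_iff)

lemma base_mem_grid: "vector [a, b] \<in> grid \<alpha> a b"
  unfolding mem_grid_iff by (rule exI[of _ 0], rule exI[of _ 0]) simp

lemma grids_shear_unit_square:
  assumes "y \<in> grids (lattice_of (shear \<alpha>))"
  obtains a b where "0 \<le> a" "a < 1" "0 \<le> b" "b < 1" "y = grid \<alpha> a b"
proof -
  obtain w where y: "y = (+) w ` lattice_of (shear \<alpha>)" using assms by (auto simp: grids_def)
  define n where "n = \<lfloor>w $ 2\<rfloor>"
  define m where "m = \<lfloor>w $ 1 - of_int n * \<alpha>\<rfloor>"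
  define z :: "real^2" where "z = vector [of_int m + of_int n * \<alpha>, of_int n]"
  define a where "a = w $ 1 - of_int n * \<alpha> - of_int m"
  define b where "b = w $ 2 - of_int n"
  have "z \<in> lattice_of (shear \<alpha>)" by (auto simp: lattice_of_shear z_def)
  have "w = vector [a, b] + z"
    by (simp add: vec_eq_iff forall_2 z_def a_def b_def)
  then have "y = (+) (vector [a, b]) ` ((+) z ` lattice_of (shear \<alpha>))"
    unfolding y image_image by (simp add: add.assoc)
  then have "y = grid \<alpha> a b"
    using lattice_of_add_image[OF \<open>z \<in> _\<close>] by (simp add: grid_def)
  moreover have "0 \<le> a" "a < 1" "0 \<le> b" "b < 1"
    unfolding a_def b_def m_def n_def by linarith+
  ultimately show ?thesis using that by blast
qed

lemma setdist_grid_le: "setdist (grid \<alpha> a b) (grid \<alpha> a' b') \<le> \<bar>a - a'\<bar> + \<bar>b - b'\<bar>"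
proof -
  have "setdist (grid \<alpha> a b) (grid \<alpha> a' b') \<le> dist (vector [a, b]) (vector [a', b'] :: real^2)"
    by (intro setdist_le_dist base_mem_grid)
  also have "\<dots> \<le> (\<Sum>i\<in>UNIV. \<bar>(vector [a, b] - vector [a', b'] :: real^2) $ i\<bar>)"
    unfolding dist_norm by (rule norm_le_l1_cart)
  finally show ?thesis by (simp add: sum_2)
qed

text \<open>
  Locally the torus is isometric to the plane: two representatives that differ by less than half of
  the shortest nonzero lattice vector realise the distance, and here every nonzero lattice vector
  with \<open>n = 0\<close> has first coordinate of absolute value at least \<open>1\<close>, and every other one has such a
  second coordinate.
\<close>

lemma setdist_grid_ge:
  assumes "\<bar>a - a'\<bar> \<le> 1/3" "\<bar>b - b'\<bar> \<le> 1/3"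
  shows "\<bar>a - a'\<bar> \<le> setdist (grid \<alpha> a b) (grid \<alpha> a' b') \<and>
         \<bar>b - b'\<bar> \<le> setdist (grid \<alpha> a b) (grid \<alpha> a' b')"
proof -
  have "max \<bar>a - a'\<bar> \<bar>b - b'\<bar> \<le> setdist (grid \<alpha> a b) (grid \<alpha> a' b')"
  proof (rule le_setdistI)
    show "grid \<alpha> a b \<noteq> {}" "grid \<alpha> a' b' \<noteq> {}" using base_mem_grid by blast+
    fix v v' assume "v \<in> grid \<alpha> a b" "v' \<in> grid \<alpha> a' b'"
    then obtain m n m' n' where
      v: "v $ 1 = a + (of_int m + of_int n * \<alpha>)" "v $ 2 = b + of_int n" and
      v': "v' $ 1 = a' + (of_int m' + of_int n' * \<alpha>)" "v' $ 2 = b' + of_int n'"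
      unfolding mem_grid_iff by blast
    have d: "\<bar>v $ i - v' $ i\<bar> \<le> dist v v'" for i
      using component_le_norm_cart[of "v - v'" i] by (simp add: dist_norm)
    consider "n \<noteq> n'" | "n = n'" "m \<noteq> m'" | "n = n'" "m = m'" by blast
    then show "max \<bar>a - a'\<bar> \<bar>b - b'\<bar> \<le> dist v v'"
    proof cases
      case 1
      then have "1 \<le> \<bar>real_of_int n - real_of_int n'\<bar>" by linarith
      then show ?thesis using d[of 2] v v' assms by linarith
    next
      case 2
      then have "1 \<le> \<bar>real_of_int m - real_of_int m'\<bar>" by linarith
      moreover have "v $ 1 - v' $ 1 = (a - a') + (of_int m - of_int m')"
        using v v' 2 by simp
      ultimately have "2 / 3 \<le> dist v v'" using d[of 1] assms(1) by linarith
      then show ?thesis using assms by simp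
    next
      case 3
      then show ?thesis using d[of 1] d[of 2] v v' by simp
    qed
  qed
  then show ?thesis by simp
qed

text \<open>
  The unit square, which represents every grid, is cut into \<open>N\<^sup>2\<close> squares of side \<open>1/N\<close>; the total
  weight \<open>N\<^sup>2 (2/N)\<^sup>s\<close> tends to \<open>0\<close>.
\<close>

lemma hausdorff_measure_grids_eq_0:
  assumes "2 < s" "A \<subseteq> grids (lattice_of (shear \<alpha>))"
  shows "hausdorff_measure (grids (lattice_of (shear \<alpha>))) setdist s A = 0"
proof -
  let ?G = "grids (lattice_of (shear \<alpha>))"
  have le: "(INF U\<in>delta_covers ?G setdist \<delta> A. \<Sum>i. diam_power setdist s (U i))
      \<le> ennreal ((real N)\<^sup>2 * (2 / real N) powr s)" if "0 < N" "2 / real N \<le> \<delta>" for \<delta> N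
  proof -
    define U where "U l = (if l < N * N then (\<lambda>(a, b). grid \<alpha> a b) `
      ({real (l div N) / N .. (real (l div N) + 1) / N} \<times>
       {real (l mod N) / N .. (real (l mod N) + 1) / N}) else {})" for l
    have dist: "setdist y z \<le> 2 / real N" if "y \<in> U l" "z \<in> U l" for y z l
    proof -
      from that obtain a b a' b' where yz: "y = grid \<alpha> a b" "z = grid \<alpha> a' b'" and
        "a \<in> {real (l div N) / N .. (real (l div N) + 1) / N}"
        "a' \<in> {real (l div N) / N .. (real (l div N) + 1) / N}"
        "b \<in> {real (l mod N) / N .. (real (l mod N) + 1) / N}"
        "b' \<in> {real (l mod N) / N .. (real (l mod N) + 1) / N}"
        by (auto simp: U_def split: if_splits)
      then have "\<bar>a - a'\<bar> \<le> 1 / N" "\<bar>b - b'\<bar> \<le> 1 / N" by (auto simp: add_divide_distrib)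
      then show ?thesis using setdist_grid_le[of \<alpha> a b a' b'] yz by simp
    qed
    have "?G \<subseteq> (\<Union>l. U l)"
    proof
      fix y assume "y \<in> ?G"
      then obtain a b where ab: "0 \<le> a" "a < 1" "0 \<le> b" "b < 1" "y = grid \<alpha> a b"
        by (rule grids_shear_unit_square)
      define i where "i = nat \<lfloor>a * N\<rfloor>"
      define j where "j = nat \<lfloor>b * N\<rfloor>"
      have i: "real i \<le> a * N" "a * N < real i + 1" and j: "real j \<le> b * N" "b * N < real j + 1"
        unfolding i_def j_def using ab by (simp_all add: of_nat_floor)
      have "a * N < N" "b * N < N" using ab \<open>0 < N\<close> by simp_all
      then have ij: "i < N" "j < N" using i j by linarith+
      have "i * N + j < N * N"
      proof -
        have "i * N + j < (i + 1) * N" using ij by simp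
        also have "\<dots> \<le> N * N" using ij by (intro mult_right_mono) auto
        finally show ?thesis .
      qed
      moreover have "(i * N + j) div N = i" "(i * N + j) mod N = j" using ij by simp_all
      ultimately have "y \<in> U (i * N + j)"
        unfolding U_def using i j ab \<open>0 < N\<close>
        by (auto intro!: image_eqI[where x = "(a, b)"] simp: field_simps)
      then show "y \<in> (\<Union>l. U l)" by blast
    qed
    then have "A \<subseteq> (\<Union>l. U l)" using assms(2) by blast
    moreover have "U l \<subseteq> ?G" for l by (auto simp: U_def grid_in_grids)
    moreover have "setdist y z \<le> \<delta>" if "y \<in> U l" "z \<in> U l" for y z l
      using dist[OF that] \<open>2 / real N \<le> \<delta>\<close> by linarith
    ultimately have U: "U \<in> delta_covers ?G setdist \<delta> A"
      unfolding delta_covers_def by blast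
    have w: "diam_power setdist s (U l) \<le> ennreal ((2 / real N) powr s)" for l
    proof (cases "U l = {}")
      case False
      then obtain y where "y \<in> U l" by blast
      then have "0 \<le> mdiameter setdist (U l)"
        using mdiameter_upper[of "U l" setdist "2 / real N" y y] dist setdist_pos_le[of y y]
        by (meson order_trans)
      moreover have "mdiameter setdist (U l) \<le> 2 / real N" using dist by (intro mdiameter_least) auto
      ultimately show ?thesis
        using assms(1) by (auto simp: diam_power_def intro!: ennreal_leI powr_mono2)
    qed (simp add: diam_power_def)
    have "(INF U\<in>delta_covers ?G setdist \<delta> A. \<Sum>i. diam_power setdist s (U i))
        \<le> (\<Sum>l. diam_power setdist s (U l))" by (rule INF_lower[OF U])
    also have "\<dots> = (\<Sum>l<N * N. diam_power setdist s (U l))"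
      by (rule suminf_finite) (auto simp: U_def diam_power_def)
    also have "\<dots> \<le> (\<Sum>l<N * N. ennreal ((2 / real N) powr s))" by (intro sum_mono w)
    also have "\<dots> = ennreal ((real N)\<^sup>2 * (2 / real N) powr s)"
      by (simp add: ennreal_mult' power2_eq_square ennreal_of_nat_eq_real_of_nat)
    finally show ?thesis .
  qed
  have "(INF U\<in>delta_covers ?G setdist \<delta> A. \<Sum>i. diam_power setdist s (U i)) = 0" if "0 < \<delta>" for \<delta>
  proof -
    have lim: "(\<lambda>N. ennreal ((real N)\<^sup>2 * (2 / real N) powr s)) \<longlonglongrightarrow> ennreal 0"
    proof (rule tendsto_ennrealI)
      have "(\<lambda>N. 2 powr s * real N powr (2 - s)) \<longlonglongrightarrow> 2 powr s * 0"
        using assms(1) by (intro tendsto_intros tendsto_neg_powr filterlim_real_sequentially) auto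
      moreover have "\<forall>\<^sub>F N in sequentially.
          2 powr s * real N powr (2 - s) = (real N)\<^sup>2 * (2 / real N) powr s"
        using eventually_gt_at_top[of 0]
      proof eventually_elim
        case (elim N)
        then have "real N powr (2 - s) = (real N)\<^sup>2 / real N powr s"
          by (simp add: powr_diff)
        then show ?case by (simp add: powr_divide)
      qed
      ultimately show "(\<lambda>N. (real N)\<^sup>2 * (2 / real N) powr s) \<longlonglongrightarrow> 0"
        unfolding mult_zero_right by (rule Lim_transform_eventually)
    qed
    have "\<forall>\<^sub>F N in sequentially. 2 / \<delta> \<le> real N"
      using filterlim_real_sequentially unfolding filterlim_at_top by blast
    then have "\<forall>\<^sub>F N in sequentially.
        (INF U\<in>delta_covers ?G setdist \<delta> A. \<Sum>i. diam_power setdist s (U i))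
        \<le> ennreal ((real N)\<^sup>2 * (2 / real N) powr s)"
      using eventually_gt_at_top[of 0]
      by eventually_elim (rule le, auto simp: field_simps that)
    then have "(INF U\<in>delta_covers ?G setdist \<delta> A. \<Sum>i. diam_power setdist s (U i)) \<le> ennreal 0"
      by (intro tendsto_lowerbound[OF lim]) auto
    then show ?thesis by simp
  qed
  then show ?thesis by (auto simp: hausdorff_measure_def)
qed

section \<open>A number with rapidly growing convergents\<close>

text \<open>
  With a minus sign in the recursion (a negative continued fraction, with partial quotients
  \<open>7, 10, 13, \<dots>\<close>) the determinant of two consecutive convergents is always \<open>1\<close> and does not
  alternate, so that they give bases of the same orientation and approximate \<open>\<alpha>\<close> from one side. The
  partial quotients are just large enough for an interval of level \<open>k\<close> in the Cantor set below to
  contain \<open>k + 1\<close> intervals of the next level.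
\<close>

fun conv_den :: "nat \<Rightarrow> int" where
  "conv_den 0 = 1"
| "conv_den (Suc 0) = 7"
| "conv_den (Suc (Suc k)) = (3 * int k + 10) * conv_den (Suc k) - conv_den k"

fun conv_num :: "nat \<Rightarrow> int" where
  "conv_num 0 = 0"
| "conv_num (Suc 0) = 1"
| "conv_num (Suc (Suc k)) = (3 * int k + 10) * conv_num (Suc k) - conv_num k"

lemma conv_det: "conv_num (Suc k) * conv_den k - conv_num k * conv_den (Suc k) = 1"
proof (induction k)
  case (Suc k)
  have "conv_num (Suc (Suc k)) * conv_den (Suc k) - conv_num (Suc k) * conv_den (Suc (Suc k))
      = conv_num (Suc k) * conv_den k - conv_num k * conv_den (Suc k)"
    by (simp add: algebra_simps)
  then show ?case using Suc by simp
qed simp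

lemma conv_den_growth: "0 < conv_den k \<and> 3 * (int k + 2) * conv_den k \<le> conv_den (Suc k)"
proof (induction k)
  case (Suc k)
  have "1 * conv_den k \<le> 3 * (int k + 2) * conv_den k"
    using Suc by (intro mult_right_mono) auto
  then have "conv_den k \<le> conv_den (Suc k)" "0 < conv_den (Suc k)" using Suc by linarith+
  then show ?case by (auto simp: algebra_simps)
qed simp

lemma conv_den_pos: "0 < conv_den k"
  using conv_den_growth by blast

lemma conv_den_mono: "6 * conv_den k \<le> conv_den (Suc k)"
proof -
  have "6 * conv_den k \<le> 3 * (int k + 2) * conv_den k"
    using conv_den_pos[of k] by (intro mult_right_mono) auto
  then show ?thesis using conv_den_growth[of k] by linarith
qed

lemma conv_den_ge: "int k < conv_den k"
proof (induction k)
  case (Suc k)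
  then show ?case using conv_den_mono[of k] conv_den_pos[of k] by linarith
qed simp

lemma conv_den_le: "conv_den k \<le> 7 ^ k * fact k"
proof (induction k)
  case (Suc k)
  have "conv_den (Suc k) \<le> 7 * (int k + 1) * conv_den k"
  proof (cases k)
    case (Suc j)
    have "(3 * int j + 10) * conv_den k \<le> (7 * (int k + 1)) * conv_den k"
      using Suc conv_den_pos[of k] by (intro mult_right_mono) auto
    then show ?thesis using Suc conv_den_pos[of j] by simp
  qed simp
  also have "\<dots> \<le> 7 * (int k + 1) * (7 ^ k * fact k)" using Suc by (intro mult_left_mono) auto
  finally show ?case by (simp add: algebra_simps)
qed simp

lemma nested_intervals_common_point:
  fixes l u :: "nat \<Rightarrow> real"
  assumes "\<And>k. l k \<le> l (Suc k)" "\<And>k. u (Suc k) \<le> u k" "\<And>k. l k \<le> u k"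
  shows "\<exists>x. \<forall>k. l k \<le> x \<and> x \<le> u k"
proof -
  have lu: "l m \<le> u n" for m n
    using lift_Suc_mono_le[of l, OF assms(1), of m "max m n"] assms(3)[of "max m n"]
      lift_Suc_antimono_le[of u, OF assms(2), of n "max m n"] by linarith
  then have "bdd_above (range l)" by (auto intro!: bdd_aboveI)
  then have "l k \<le> (SUP k. l k) \<and> (SUP k. l k) \<le> u k" for k
    using lu by (auto intro!: cSUP_upper cSUP_least)
  then show ?thesis by blast
qed

text \<open>
  The fractions \<open>p\<^sub>k/q\<^sub>k\<close> increase by \<open>1/(q\<^sub>k q\<^sub>k\<^sub>+\<^sub>1)\<close>, and these increments decay at least geometrically,
  so from step \<open>k\<close> on they add up to at most twice the first of them.
\<close>

lemma exists_real_with_convergents: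
  "\<exists>\<alpha>::real. \<forall>k. 0 \<le> conv_den k * \<alpha> - conv_num k \<and> conv_den k * \<alpha> - conv_num k \<le> 2 / conv_den (Suc k)"
proof -
  let ?q = "\<lambda>k. real_of_int (conv_den k)" and ?p = "\<lambda>k. real_of_int (conv_num k)"
  have q: "0 < ?q k" "0 \<le> ?q k" for k using conv_den_pos[of k] by simp_all
  have step: "?p (Suc k) / ?q (Suc k) = ?p k / ?q k + 1 / (?q k * ?q (Suc k))" for k
  proof -
    have "?p (Suc k) * ?q k - ?p k * ?q (Suc k) = 1"
      using conv_det[of k] by (metis of_int_1 of_int_diff of_int_mult)
    then show ?thesis using q[of k] q[of "Suc k"] by (simp add: field_simps)
  qed
  have "\<exists>\<alpha>. \<forall>k. ?p k / ?q k \<le> \<alpha> \<and> \<alpha> \<le> ?p k / ?q k + 2 / (?q k * ?q (Suc k))"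
  proof (rule nested_intervals_common_point)
    fix k
    show "?p k / ?q k \<le> ?p (Suc k) / ?q (Suc k)" unfolding step[of k] using q by simp
    show "?p k / ?q k \<le> ?p k / ?q k + 2 / (?q k * ?q (Suc k))" using q(2) by simp
    have "2 * ?q k \<le> ?q (Suc (Suc k))"
      using conv_den_mono[of k] conv_den_mono[of "Suc k"] conv_den_pos[of k] by linarith
    then have "2 / (?q (Suc k) * ?q (Suc (Suc k))) \<le> 2 / (?q (Suc k) * (2 * ?q k))"
      using q by (intro divide_left_mono mult_left_mono mult_pos_pos) (simp_all only: zero_less_numeral zero_le_numeral)
    then show "?p (Suc k) / ?q (Suc k) + 2 / (?q (Suc k) * ?q (Suc (Suc k)))
        \<le> ?p k / ?q k + 2 / (?q k * ?q (Suc k))"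
      unfolding step[of k] by (simp add: mult.commute)
  qed
  then obtain \<alpha> where \<alpha>: "?p k / ?q k \<le> \<alpha>" "\<alpha> \<le> ?p k / ?q k + 2 / (?q k * ?q (Suc k))" for k
    by blast
  have "0 \<le> ?q k * \<alpha> - ?p k \<and> ?q k * \<alpha> - ?p k \<le> 2 / ?q (Suc k)" for k
    using \<alpha>[of k] q[of k] q[of "Suc k"] by (simp add: field_simps)
  then show ?thesis by blast
qed

section \<open>A Cantor set adapted to the denominators\<close>

text \<open>
  Digits of the factorial number system: \<open>y = \<lfloor>y\<rfloor> + (\<Sum>k. factorial_digit y k / (k + 1)!)\<close>. The
  radix \<open>k + 1\<close> grows, but no faster than \<open>q\<^sub>k\<^sub>+\<^sub>1/q\<^sub>k\<close>.
\<close>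

definition factorial_digit :: "real \<Rightarrow> nat \<Rightarrow> int" where
  "factorial_digit y k = \<lfloor>y * fact (Suc k)\<rfloor> - (int k + 1) * \<lfloor>y * fact k\<rfloor>"

lemma factorial_digit_bounds: "0 \<le> factorial_digit y k" "factorial_digit y k \<le> int k"
proof -
  define f where "f = y * fact k"
  have y: "y * fact (Suc k) = (real k + 1) * f" by (simp add: f_def algebra_simps)
  have "(real k + 1) * \<lfloor>f\<rfloor> \<le> (real k + 1) * f" by (intro mult_left_mono) auto
  then have "of_int ((int k + 1) * \<lfloor>f\<rfloor>) \<le> (real k + 1) * f" by simp
  then show "0 \<le> factorial_digit y k"
    unfolding factorial_digit_def y f_def[symmetric] le_diff_eq by (simp add: le_floor_iff)
  have "(real k + 1) * f < (real k + 1) * (\<lfloor>f\<rfloor> + 1)"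
    by (intro mult_strict_left_mono) linarith+
  then have "(real k + 1) * f < of_int ((int k + 1) * \<lfloor>f\<rfloor> + int k + 1)"
    by (simp add: algebra_simps)
  then show "factorial_digit y k \<le> int k"
    unfolding factorial_digit_def y f_def[symmetric] floor_less_iff[symmetric] by linarith
qed

text \<open>
  The interval of level \<open>k\<close> that belongs to \<open>y\<close> consists of the \<open>a\<close> with
  \<open>q\<^sub>k a \<in> cell y k + [1/3, 2/3]\<close>. The ceiling finds the first integer that gives a subinterval on the
  next level, and the digit of \<open>y\<close> chooses among the first \<open>k + 1\<close> of them.
\<close>

fun cell :: "real \<Rightarrow> nat \<Rightarrow> int" where
  "cell y 0 = 0"
| "cell y (Suc k) =
     \<lceil>conv_den (Suc k) * ((cell y k + 1 / 3) / conv_den k)\<rceil> + factorial_digit y k"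

lemma exists_point_in_cells:
  "\<exists>x::real. \<forall>k. cell y k + 1 / 3 \<le> conv_den k * x \<and> conv_den k * x \<le> cell y k + 2 / 3"
proof -
  let ?q = "\<lambda>k. real_of_int (conv_den k)"
  have q: "0 < ?q k" for k using conv_den_pos by simp
  have "\<exists>x. \<forall>k. (cell y k + 1 / 3) / ?q k \<le> x \<and> x \<le> (cell y k + 2 / 3) / ?q k"
  proof (rule nested_intervals_common_point)
    fix k
    define L where "L = (cell y k + 1 / 3) / ?q k"
    have cell: "cell y (Suc k) = \<lceil>?q (Suc k) * L\<rceil> + factorial_digit y k"
      by (simp add: L_def)
    have "?q (Suc k) * L \<le> cell y (Suc k)"
      unfolding cell using factorial_digit_bounds(1)[of y k] by linarith
    then show "(cell y k + 1 / 3) / ?q k \<le> (cell y (Suc k) + 1 / 3) / ?q (Suc k)"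
      unfolding L_def[symmetric] using q[of "Suc k"] by (simp add: pos_le_divide_eq mult.commute)
    have "cell y (Suc k) < ?q (Suc k) * L + 1 + real k"
      unfolding cell using factorial_digit_bounds(2)[of y k] by linarith
    moreover have "3 * (real k + 2) * ?q k \<le> ?q (Suc k)"
      using conv_den_growth[of k] by (metis (mono_tags, lifting) of_int_add of_int_le_iff of_int_mult of_int_numeral of_int_of_nat_eq)
    then have "real k + 2 \<le> ?q (Suc k) * (1 / (3 * ?q k))"
      using q[of k] by (simp add: field_simps)
    moreover have "?q (Suc k) * ((cell y k + 2 / 3) / ?q k) = ?q (Suc k) * L + ?q (Suc k) * (1 / (3 * ?q k))"
      using q[of k] by (simp add: L_def field_simps)
    ultimately have "cell y (Suc k) + 2 / 3 \<le> ?q (Suc k) * ((cell y k + 2 / 3) / ?q k)"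
      by linarith
    then show "(cell y (Suc k) + 2 / 3) / ?q (Suc k) \<le> (cell y k + 2 / 3) / ?q k"
      using q[of "Suc k"] by (simp only: pos_divide_le_eq mult.commute)
  next
    fix k
    show "(cell y k + 1 / 3) / ?q k \<le> (cell y k + 2 / 3) / ?q k"
      using q[of k] by (intro divide_right_mono) auto
  qed
  then show ?thesis using q by (simp add: pos_le_divide_eq pos_divide_le_eq mult.commute)
qed

definition cell_point :: "real \<Rightarrow> real" where
  "cell_point y = (SOME x::real. \<forall>k. cell y k + 1 / 3 \<le> conv_den k * x \<and> conv_den k * x \<le> cell y k + 2 / 3)"

lemma cell_point:
  "cell y k + 1 / 3 \<le> conv_den k * cell_point y" "conv_den k * cell_point y \<le> cell y k + 2 / 3"
  using someI_ex[OF exists_point_in_cells[of y]] unfolding cell_point_def by blast+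

lemma cell_cong:
  assumes "\<And>j. j \<le> k \<Longrightarrow> \<lfloor>y * fact j\<rfloor> = \<lfloor>y' * fact j\<rfloor>"
  shows "cell y k = cell y' k"
  using assms by (induction k) (simp_all add: factorial_digit_def del: fact_Suc)

text \<open>
  At the first level where \<open>y\<close> and \<open>y'\<close> have different digits, with difference \<open>D\<close>, the intervals
  have the same parent. Their left ends are \<open>D/q\<^sub>k\<^sub>+\<^sub>1\<close> apart, of which the length of an interval takes
  away \<open>1/(3q\<^sub>k\<^sub>+\<^sub>1)\<close>; as \<open>D \<ge> 1\<close>, what is left is at least \<open>(D + 1)/(3q\<^sub>k\<^sub>+\<^sub>1)\<close>.
\<close>

lemma cell_point_separation:
  assumes "0 \<le> y" "y < 1" "0 \<le> y'" "y' < 1" "y \<noteq> y'"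
  obtains k D where "1 \<le> D" "D \<le> real k" "\<bar>y - y'\<bar> \<le> (D + 1) / fact (Suc k)"
    "(D + 1) / (3 * real_of_int (conv_den (Suc k))) \<le> \<bar>cell_point y - cell_point y'\<bar>"
proof -
  have "\<exists>k. \<lfloor>y * fact k\<rfloor> \<noteq> \<lfloor>y' * fact k\<rfloor>"
  proof -
    obtain k where k: "1 / \<bar>y - y'\<bar> < real k" using reals_Archimedean2 by blast
    have "1 < real k * \<bar>y - y'\<bar>" using k assms(5) by (simp add: field_simps)
    also have "\<dots> \<le> fact k * \<bar>y - y'\<bar>"
      using fact_ge_self[of k] by (intro mult_right_mono) (metis of_nat_fact of_nat_le_iff, simp)
    also have "\<dots> = \<bar>fact k * (y - y')\<bar>"
      by (simp add: abs_mult)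
    also have "fact k * (y - y') = y * fact k - y' * fact k"
      by (simp add: algebra_simps)
    finally have "\<lfloor>y * fact k\<rfloor> \<noteq> \<lfloor>y' * fact k\<rfloor>" by linarith
    then show ?thesis by blast
  qed
  then obtain n where n: "\<lfloor>y * fact n\<rfloor> \<noteq> \<lfloor>y' * fact n\<rfloor>" and
    least: "\<And>j. j < n \<Longrightarrow> \<lfloor>y * fact j\<rfloor> = \<lfloor>y' * fact j\<rfloor>"
    using exists_least_iff[of "\<lambda>k. \<lfloor>y * fact k\<rfloor> \<noteq> \<lfloor>y' * fact k\<rfloor>"] by blast
  have "\<lfloor>y\<rfloor> = 0" "\<lfloor>y'\<rfloor> = 0" using assms by linarith+
  then have "n \<noteq> 0" using n by (metis fact_0 mult.right_neutral)
  then obtain k where k: "n = Suc k" by (cases n) auto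
  define D where "D = real_of_int \<bar>factorial_digit y k - factorial_digit y' k\<bar>"
  have fl: "factorial_digit y k - factorial_digit y' k = \<lfloor>y * fact (Suc k)\<rfloor> - \<lfloor>y' * fact (Suc k)\<rfloor>"
    using least[of k] k by (simp add: factorial_digit_def del: fact_Suc)
  have "cell y k = cell y' k" using least k by (intro cell_cong) auto
  then have cells: "cell y (Suc k) - cell y' (Suc k) = factorial_digit y k - factorial_digit y' k"
    by simp
  show ?thesis
  proof (rule that)
    show D1: "1 \<le> D" using n k fl by (simp add: D_def del: fact_Suc)
    show "D \<le> real k"
      using factorial_digit_bounds[of y k] factorial_digit_bounds[of y' k] by (simp add: D_def)
    have "\<bar>y * fact (Suc k) - y' * fact (Suc k)\<bar> \<le> D + 1"
      unfolding D_def fl by linarith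
    moreover have "\<bar>y * fact (Suc k) - y' * fact (Suc k)\<bar> = \<bar>y - y'\<bar> * fact (Suc k)"
      unfolding left_diff_distrib[symmetric] abs_mult by (simp del: fact_Suc)
    ultimately show "\<bar>y - y'\<bar> \<le> (D + 1) / fact (Suc k)"
      by (simp add: pos_le_divide_eq del: fact_Suc)
    let ?q = "real_of_int (conv_den (Suc k))"
    have q: "0 < ?q" using conv_den_pos by simp
    have "(D + 1) / 3 \<le> D - 1 / 3" using D1 by (simp add: field_simps)
    also have "\<dots> \<le> \<bar>?q * cell_point y - ?q * cell_point y'\<bar>"
      using cell_point[where y = y and k = "Suc k"] cell_point[where y = y' and k = "Suc k"] cells unfolding D_def by linarith
    also have "\<dots> = ?q * \<bar>cell_point y - cell_point y'\<bar>"
      unfolding right_diff_distrib[symmetric] abs_mult using q by simp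
    finally have "(D + 1) / 3 \<le> ?q * \<bar>cell_point y - cell_point y'\<bar>" .
    then show "(D + 1) / (3 * ?q) \<le> \<bar>cell_point y - cell_point y'\<bar>"
      using q by (simp add: field_simps)
  qed
qed

lemma power_over_fact_le_exp:
  fixes x :: real
  assumes "0 \<le> x"
  shows "x ^ k / fact k \<le> exp x"
proof -
  have "(\<Sum>n\<in>{k}. x ^ n /\<^sub>R fact n) \<le> (\<Sum>n. x ^ n /\<^sub>R fact n)"
    using assms by (intro sum_le_suminf summable_exp_generic) auto
  then show ?thesis by (simp add: exp_def divide_inverse mult.commute)
qed

text \<open>
  By \<open>cell_point_separation\<close> the images are at least \<open>1/(21 \<cdot> 7\<^sup>k T)\<close> apart when the arguments are at
  most \<open>1/T\<close> apart, for some \<open>T \<ge> k!\<close>. The exponential factor, which collects the constant losses of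
  all levels, is negligible against any positive power of \<open>k!\<close>.
\<close>

lemma cell_point_inverse_Holder:
  assumes "0 < \<sigma>" "\<sigma> < 1"
  obtains C where "0 \<le> C" "\<And>y y'. 0 \<le> y \<Longrightarrow> y < 1 \<Longrightarrow> 0 \<le> y' \<Longrightarrow> y' < 1 \<Longrightarrow>
     \<bar>y - y'\<bar> \<le> C * \<bar>cell_point y - cell_point y'\<bar> powr \<sigma>"
proof -
  \<comment> \<open>The base is chosen such that \<open>(B\<^sup>k)\<^sup>1\<^sup>-\<^sup>\<sigma> = 7\<^sup>k\<close>; then \<open>B\<^sup>k/k! \<le> exp B\<close> absorbs the losses.\<close>
  define B where "B = (7::real) powr (1 / (1 - \<sigma>))"
  define C where "C = 21 * exp B powr (1 - \<sigma>)"
  have bound: "7 ^ k * fact k powr (\<sigma> - 1) \<le> exp B powr (1 - \<sigma>)" for k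
  proof -
    have "(B ^ k / fact k) powr (1 - \<sigma>) \<le> exp B powr (1 - \<sigma>)"
      using assms by (intro powr_mono2 power_over_fact_le_exp) (auto simp: B_def)
    moreover have "(B ^ k / fact k) powr (1 - \<sigma>) = (B ^ k) powr (1 - \<sigma>) * fact k powr (\<sigma> - 1)"
    proof -
      have "fact k powr (\<sigma> - 1) = 1 / (fact k :: real) powr (1 - \<sigma>)"
        using powr_minus_divide[of "fact k :: real" "1 - \<sigma>"] by simp
      moreover have "0 \<le> B" by (simp add: B_def)
      ultimately show ?thesis by (simp add: powr_divide)
    qed
    moreover have "(B ^ k) powr (1 - \<sigma>) = 7 ^ k"
    proof -
      have "B ^ k = 7 powr (real k / (1 - \<sigma>))"
        by (simp add: B_def powr_powr flip: powr_realpow)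
      then show ?thesis using assms by (simp add: powr_powr powr_realpow)
    qed
    ultimately show ?thesis by simp
  qed
  have "\<bar>y - y'\<bar> \<le> C * \<bar>cell_point y - cell_point y'\<bar> powr \<sigma>"
    if y: "0 \<le> y" "y < 1" "0 \<le> y'" "y' < 1" and ne: "y \<noteq> y'" for y y'
  proof -
    obtain k D where kD: "1 \<le> D" "D \<le> real k" "\<bar>y - y'\<bar> \<le> (D + 1) / fact (Suc k)"
      "(D + 1) / (3 * real_of_int (conv_den (Suc k))) \<le> \<bar>cell_point y - cell_point y'\<bar>"
      using cell_point_separation[OF y ne] by metis
    define T where "T = fact (Suc k) / (D + 1)"
    have T: "fact k \<le> T"
      using kD by (simp add: T_def field_simps)
    have Tpos: "0 < T" using T fact_gt_zero[of k] by (rule less_le_trans[rotated])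
    have q: "0 < conv_den (Suc k)" by (rule conv_den_pos)
    have "real_of_int (conv_den (Suc k)) \<le> of_int (7 ^ Suc k * fact (Suc k))"
      using conv_den_le[of "Suc k"] by (simp only: of_int_le_iff)
    then have "real_of_int (3 * conv_den (Suc k)) \<le> (21 * 7 ^ k) * fact (Suc k)"
      by (simp add: mult_ac del: fact_Suc)
    then have "(D + 1) / ((21 * 7 ^ k) * fact (Suc k)) \<le> (D + 1) / (3 * real_of_int (conv_den (Suc k)))"
      using kD q by (intro divide_left_mono) (auto simp del: fact_Suc)
    then have "1 / ((21 * 7 ^ k) * T) \<le> \<bar>cell_point y - cell_point y'\<bar>"
      using kD by (simp add: T_def)
    then have "(1 / ((21 * 7 ^ k) * T)) powr \<sigma> \<le> \<bar>cell_point y - cell_point y'\<bar> powr \<sigma>"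
      using assms Tpos by (intro powr_mono2) auto
    moreover have "1 / T \<le> C * (1 / ((21 * 7 ^ k) * T)) powr \<sigma>"
    proof -
      have "1 \<le> 21 * (7::real) ^ k" using one_le_power[of "7::real" k] by linarith
      then have "(21 * 7 ^ k) powr \<sigma> * T powr (\<sigma> - 1) \<le> (21 * 7 ^ k) powr 1 * fact k powr (\<sigma> - 1)"
        using assms T by (intro mult_mono powr_mono powr_mono2') auto
      also have "\<dots> \<le> C" using bound[of k] by (simp add: C_def mult.assoc)
      finally have "(21 * 7 ^ k) powr \<sigma> * T powr \<sigma> / T \<le> C"
        using Tpos by (simp add: powr_diff)
      then have "((21 * 7 ^ k) * T) powr \<sigma> / T \<le> C"
        using Tpos by (simp add: powr_mult)
      then show ?thesis
        using Tpos by (simp add: powr_divide field_simps)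
    qed
    moreover have "\<bar>y - y'\<bar> \<le> 1 / T" using kD by (simp add: T_def)
    moreover have "0 \<le> C" by (simp add: C_def)
    ultimately show ?thesis by (meson mult_left_mono order_trans)
  qed
  then have "\<bar>y - y'\<bar> \<le> C * \<bar>cell_point y - cell_point y'\<bar> powr \<sigma>"
    if y: "0 \<le> y" "y < 1" "0 \<le> y'" "y' < 1" for y y'
    using that by (cases "y = y'") auto
  then show ?thesis by (intro that[of C]) (auto simp: C_def)
qed

section \<open>Non-singularity\<close>

lemma diag_flow_mult: "diag_flow t *v v = vector [exp t * v $ 1, exp (- t) * v $ 2]"
  by (simp add: diag_flow_def vec_eq_iff forall_2 matrix_vector_mult_def sum_2)

lemma det_diag_flow: "det (diag_flow t) = 1"
  by (simp add: det_2 diag_flow_def flip: exp_add)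

lemma flow_lattice_of: "(*v) (diag_flow t) ` lattice_of g = lattice_of (diag_flow t ** g)"
  by (simp add: lattice_of_def image_image matrix_vector_mul_assoc)

text \<open>
  These sets are enough to detect non-divergence: one constant \<open>B\<close> for a sequence of times that
  tends to infinity contradicts divergence.
\<close>

lemma compactin_lattices_with_bounded_basis:
  "compactin lattice_space (lattice_of ` {g \<in> SL2R. \<forall>i j. \<bar>g $ i $ j\<bar> \<le> B})"
proof (rule image_compactin)
  show "continuous_map (top_of_set SL2R) lattice_space lattice_of"
    by (intro quotient_imp_continuous_map quotient_map_lattice_of)
  let ?S = "{g \<in> SL2R. \<forall>i j. \<bar>g $ i $ j\<bar> \<le> B}"
  have "norm g \<le> 4 * B" if "g \<in> ?S" for g
  proof -
    have row: "norm (g $ i) \<le> 2 * B" for i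
    proof -
      have "\<bar>g $ i $ 1\<bar> \<le> B" "\<bar>g $ i $ 2\<bar> \<le> B" using that by blast+
      then show ?thesis using norm_le_l1_cart[of "g $ i"] by (simp add: sum_2)
    qed
    have "norm g \<le> (\<Sum>i\<in>UNIV. norm (g $ i))"
      by (simp add: norm_vec_def L2_set_le_sum)
    then show ?thesis using row[of 1] row[of 2] by (simp add: sum_2)
  qed
  then have "bounded ?S" by (rule boundedI)
  moreover have "closed ?S"
  proof -
    have "?S = {g. det g = 1} \<inter> (\<Inter>i. \<Inter>j. {g. \<bar>g $ i $ j\<bar> \<le> B})"
      by (auto simp: SL2R_def)
    moreover have "closed {g::real^2^2. det g = 1}"
      unfolding det_2 by (intro closed_Collect_eq continuous_intros)
    moreover have "closed {g::real^2^2. \<bar>g $ i $ j\<bar> \<le> B}" for i j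
      by (intro closed_Collect_le continuous_intros)
    ultimately show ?thesis by (simp add: closed_INT closed_Int)
  qed
  ultimately show "compactin (top_of_set SL2R) ?S"
    by (auto simp: compactin_subtopology compact_eq_bounded_closed)
qed

text \<open>
  The vectors \<open>(q\<^sub>j \<alpha> - p\<^sub>j, q\<^sub>j)\<close> with \<open>j = k, k + 1\<close> form a basis of the lattice because the
  convergents have determinant \<open>1\<close>. At the time \<open>ln q\<^sub>k\<^sub>+\<^sub>1\<close> their second coordinates become
  \<open>q\<^sub>k/q\<^sub>k\<^sub>+\<^sub>1\<close> and \<open>1\<close>, and their first coordinates are multiplied by \<open>q\<^sub>k\<^sub>+\<^sub>1\<close>, which the
  approximation by convergents compensates.
\<close>

lemma nonsingular_lattice_of_convergents:
  fixes \<alpha> :: real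
  assumes "\<And>k. 0 \<le> conv_den k * \<alpha> - conv_num k" "\<And>k. conv_den k * \<alpha> - conv_num k \<le> 2 / conv_den (Suc k)"
  shows "nonsingular_lattice (lattice_of (shear \<alpha>))"
proof -
  let ?K = "lattice_of ` {g \<in> SL2R. \<forall>i j. \<bar>g $ i $ j\<bar> \<le> 2}"
  let ?q = "\<lambda>k. real_of_int (conv_den k)" and ?p = "\<lambda>k. real_of_int (conv_num k)"
  have rec: "(*v) (diag_flow (ln (?q (Suc k)))) ` lattice_of (shear \<alpha>) \<in> ?K" for k
  proof -
    define t where "t = ln (?q (Suc k))"
    \<comment> \<open>The columns of \<open>M\<close> are the coordinates of the two vectors in the basis \<open>(1, 0)\<close>, \<open>(\<alpha>, 1)\<close>;
        \<open>M'\<close> is its inverse.\<close>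
    define M :: "real^2^2" where
      "M = vector [vector [- ?p k, - ?p (Suc k)], vector [?q k, ?q (Suc k)]]"
    define M' :: "real^2^2" where
      "M' = vector [vector [?q (Suc k), ?p (Suc k)], vector [- ?q k, - ?p k]]"
    define h where "h = diag_flow t ** shear \<alpha> ** M"
    have q: "0 < ?q j" for j using conv_den_pos by simp
    have q6: "6 * ?q j \<le> ?q (Suc j)" for j
      using conv_den_mono[of j] by linarith
    have et: "exp t = ?q (Suc k)" "exp (- t) = 1 / ?q (Suc k)"
      using q[of "Suc k"] by (simp_all add: t_def exp_minus divide_inverse)
    have det1: "?p (Suc k) * ?q k - ?p k * ?q (Suc k) = 1"
      using conv_det[of k] by (metis of_int_1 of_int_diff of_int_mult)
    have "det M = 1" using det1 by (simp add: M_def det_2)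
    then have "h \<in> SL2R" by (simp add: SL2R_def h_def det_mul det_diag_flow det_shear)
    moreover have "lattice_of h = (*v) (diag_flow t) ` lattice_of (shear \<alpha>)"
      unfolding h_def flow_lattice_of
    proof (rule lattice_of_mult_integral)
      show "M $ i $ j \<in> \<int>" "M' $ i $ j \<in> \<int>" for i j
        using exhaust_2[of i] exhaust_2[of j] by (auto simp: M_def M'_def)
      show "M ** M' = mat 1"
        using det1 by (simp add: M_def M'_def matrix_matrix_mult_def mat_def vec_eq_iff forall_2 sum_2 algebra_simps)
    qed
    moreover have "\<bar>h $ i $ j\<bar> \<le> 2" for i j
    proof -
      have h: "h = vector [vector [?q (Suc k) * (?q k * \<alpha> - ?p k), ?q (Suc k) * (?q (Suc k) * \<alpha> - ?p (Suc k))],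
                           vector [?q k / ?q (Suc k), 1]]"
        using q[of "Suc k"] by (simp add: h_def diag_flow_def et shear_def M_def matrix_matrix_mult_def vec_eq_iff
            forall_2 sum_2 algebra_simps)
      have "?q (Suc k) * (?q k * \<alpha> - ?p k) \<le> 2"
        using assms(2)[of k] q[of "Suc k"] by (simp add: field_simps)
      moreover have "?q (Suc k) * (?q (Suc k) * \<alpha> - ?p (Suc k)) \<le> 2"
      proof -
        have "?q (Suc k) * (?q (Suc k) * \<alpha> - ?p (Suc k)) \<le> ?q (Suc k) * (2 / ?q (Suc (Suc k)))"
          using assms(2)[of "Suc k"] q[of "Suc k"] by (intro mult_left_mono) auto
        also have "\<dots> \<le> 2" using q6[of "Suc k"] q[of "Suc k"] q[of "Suc (Suc k)"]
          by (simp add: pos_divide_le_eq del: conv_den.simps)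
        finally show ?thesis .
      qed
      moreover have "0 \<le> ?q (Suc k) * (?q k * \<alpha> - ?p k)" "0 \<le> ?q (Suc k) * (?q (Suc k) * \<alpha> - ?p (Suc k))"
        using assms(1) q less_imp_le by (blast intro: mult_nonneg_nonneg)+
      moreover have "0 \<le> ?q k / ?q (Suc k)" "?q k / ?q (Suc k) \<le> 2"
        using q[of k] q[of "Suc k"] q6[of k] by (simp_all add: pos_divide_le_eq del: conv_den.simps)
      ultimately show ?thesis
        using exhaust_2[of i] exhaust_2[of j] unfolding h by auto
    qed
    ultimately show ?thesis unfolding t_def by (intro image_eqI[where x = h]) auto
  qed
  have "\<not> divergent_orbit (lattice_of (shear \<alpha>))"
  proof
    assume "divergent_orbit (lattice_of (shear \<alpha>))"
    then obtain T where T: "\<And>t. T \<le> t \<Longrightarrow> (*v) (diag_flow t) ` lattice_of (shear \<alpha>) \<notin> ?K"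
      using compactin_lattices_with_bounded_basis[of 2]
      unfolding divergent_orbit_def eventually_at_top_linorder by blast
    \<comment> \<open>The return times are unbounded because the denominators are.\<close>
    obtain k where "exp T < real k" using reals_Archimedean2 by blast
    also have "real k \<le> ?q (Suc k)" using conv_den_ge[of "Suc k"] by linarith
    finally have "T \<le> ln (?q (Suc k))" using ln_ge_iff conv_den_pos by simp
    then show False using T rec by blast
  qed
  then show ?thesis by (simp add: nonsingular_lattice_def lattice_of_shear_unimodular)
qed

section \<open>Grids that avoid the swept set\<close>

text \<open>The width \<open>1/144\<close> is dictated by the lower bound \<open>1/72\<close> in \<open>grid_badly_approximable\<close>.\<close>

definition window :: "(real^2) set" where
  "window = {v. \<bar>v $ 1\<bar> < 1 / 144 \<and> 1 < v $ 2 \<and> v $ 2 < 2}"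

lemma open_window: "open window"
  unfolding window_def by (intro open_Collect_conj open_Collect_less continuous_intros)

lemma bounded_window: "bounded window"
proof (rule boundedI)
  fix v assume "v \<in> window"
  then show "norm v \<le> 3" using norm_le_l1_cart[of v] by (simp add: window_def sum_2)
qed

lemma window_nonempty: "window \<noteq> {}"
proof -
  have "vector [0, 3/2] \<in> window" by (simp add: window_def)
  then show ?thesis by blast
qed

text \<open>The flow preserves the product of the coordinates and contracts the second one.\<close>

lemma S_plus_window:
  assumes "v \<in> S_plus window"
  shows "1 < v $ 2" "\<bar>v $ 1\<bar> * v $ 2 < 1 / 72"
proof -
  obtain t where t: "0 < t" "\<bar>exp t * v $ 1\<bar> < 1 / 144" "1 < exp (- t) * v $ 2" "exp (- t) * v $ 2 < 2"
    using assms by (auto simp: S_plus_def window_def diag_flow_mult)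
  have v2: "v $ 2 = exp t * (exp (- t) * v $ 2)" by (simp flip: exp_add mult.assoc)
  have "1 * 1 < exp t * (exp (- t) * v $ 2)" using t by (intro mult_strict_mono) auto
  then show "1 < v $ 2" using v2 by simp
  have "\<bar>v $ 1\<bar> * v $ 2 = \<bar>exp t * v $ 1\<bar> * (exp (- t) * v $ 2)"
    by (subst v2) (simp add: abs_mult)
  also have "\<dots> < 1 / 144 * 2" using t by (intro mult_strict_mono) auto
  finally show "\<bar>v $ 1\<bar> * v $ 2 < 1 / 72" by simp
qed

text \<open>
  Multiplication of \<open>v\<^sub>1 = a + m + n\<alpha>\<close> by \<open>q\<^sub>k\<close> gives \<open>q\<^sub>k a\<close> up to an integer and an error
  \<open>n(q\<^sub>k \<alpha> - p\<^sub>k) \<le> 2v\<^sub>2/q\<^sub>k\<^sub>+\<^sub>1\<close>. If \<open>12 v\<^sub>2\<close> lies between \<open>q\<^sub>k\<close> and \<open>q\<^sub>k\<^sub>+\<^sub>1\<close>, the error is in \<open>[0, 1/6]\<close>,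
  so \<open>q\<^sub>k v\<^sub>1\<close> is in \<open>[1/3, 5/6]\<close> modulo \<open>1\<close>, whence \<open>\<bar>v\<^sub>1\<bar> \<ge> 1/(6q\<^sub>k) \<ge> 1/(72v\<^sub>2)\<close>.
\<close>

lemma grid_badly_approximable:
  fixes \<alpha> a :: real
  assumes \<alpha>: "\<And>k. 0 \<le> conv_den k * \<alpha> - conv_num k" "\<And>k. conv_den k * \<alpha> - conv_num k \<le> 2 / conv_den (Suc k)"
    and a: "\<And>k. of_int (c k) + 1 / 3 \<le> conv_den k * a" "\<And>k. conv_den k * a \<le> of_int (c k) + 2 / 3"
    and "0 \<le> b" "b \<le> 1" and v: "v \<in> grid \<alpha> a b" "1 < v $ 2"
  shows "1 / 72 \<le> \<bar>v $ 1\<bar> * v $ 2"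
proof -
  let ?q = "\<lambda>k. real_of_int (conv_den k)"
  obtain m n where mn: "v $ 1 = a + (of_int m + of_int n * \<alpha>)" "v $ 2 = b + of_int n"
    using v(1) by (auto simp: mem_grid_iff)
  obtain k0 where "12 * v $ 2 < real k0" using reals_Archimedean2 by blast
  also have "real k0 \<le> ?q k0" using conv_den_ge[of k0] by linarith
  finally have "12 * v $ 2 < ?q k0" .
  then obtain k where k: "?q k \<le> 12 * v $ 2" "12 * v $ 2 < ?q (Suc k)"
  proof (induction k0)
    case 0
    then show ?case using v(2) by simp
  next
    case (Suc k0)
    then show ?case by (meson not_le)
  qed
  have q: "0 < ?q k" "0 < ?q (Suc k)" using conv_den_pos[of k] conv_den_pos[of "Suc k"] by simp_all
  define \<delta> where "\<delta> = ?q k * \<alpha> - conv_num k"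
  have \<delta>: "0 \<le> \<delta>" "\<delta> \<le> 2 / ?q (Suc k)" using \<alpha> by (simp_all add: \<delta>_def)
  have n: "0 \<le> real_of_int n" "of_int n \<le> v $ 2" using mn v(2) assms(5,6) by linarith+
  have n\<delta>: "0 \<le> of_int n * \<delta>" "of_int n * \<delta> \<le> 1 / 6"
  proof -
    show "0 \<le> of_int n * \<delta>" using n \<delta> by simp
    have "of_int n * \<delta> \<le> v $ 2 * (2 / ?q (Suc k))" using n \<delta> v(2) by (intro mult_mono) auto
    also have "\<dots> \<le> 1 / 6" using k(2) q(2) by (simp add: field_simps)
    finally show "of_int n * \<delta> \<le> 1 / 6" .
  qed
  define N where "N = c k + conv_den k * m + n * conv_num k"
  have eq: "?q k * v $ 1 = (?q k * a - c k) + of_int N + of_int n * \<delta>"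
    by (simp add: mn N_def \<delta>_def algebra_simps)
  have "1 / 6 \<le> \<bar>?q k * v $ 1\<bar>"
  proof (cases "0 \<le> N")
    case True
    then have "0 \<le> real_of_int N" by simp
    then show ?thesis using eq n\<delta> a[of k] by linarith
  next
    case False
    then have "real_of_int N \<le> -1" by linarith
    then show ?thesis using eq n\<delta> a[of k] by linarith
  qed
  then have "1 / 6 \<le> ?q k * \<bar>v $ 1\<bar>" using q by (simp add: abs_mult)
  also have "\<dots> \<le> (12 * v $ 2) * \<bar>v $ 1\<bar>" using k(1) by (intro mult_right_mono) auto
  finally show ?thesis by (simp add: mult.commute)
qed

text \<open>
  The good grids are parametrised by \<open>(y, z) \<mapsto> (cell_point y, z/3)\<close>. The factor \<open>1/3\<close> keeps the
  parameters in a region on which the metric of the torus is that of the plane.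
\<close>

theorem proposition6p1:
  shows "\<exists>(x :: (real^2) set) (V :: (real^2) set).
           nonsingular_lattice x \<and> open V \<and> bounded V \<and> V \<noteq> {} \<and>
           hausdorff_dim (grids x) setdist (finite_grids (S_plus V) x) = 2"
proof -
  obtain \<alpha> :: real where \<alpha>: "\<And>k. 0 \<le> conv_den k * \<alpha> - conv_num k"
      "\<And>k. conv_den k * \<alpha> - conv_num k \<le> 2 / conv_den (Suc k)"
    using exists_real_with_convergents by blast
  define x where "x = lattice_of (shear \<alpha>)"
  define F where "F = finite_grids (S_plus window) x"
  define \<phi> where "\<phi> = (\<lambda>(y, z). grid \<alpha> (cell_point y) (z / 3))"
  have "hausdorff_measure (grids x) setdist s F = 0" if "2 < s" for s
    unfolding x_def using that
    by (intro hausdorff_measure_grids_eq_0) (auto simp: F_def x_def finite_grids_def)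
  moreover have "hausdorff_measure (grids x) setdist s F \<noteq> 0" if s: "0 < s" "s < 2" for s
  proof -
    obtain C where C: "0 \<le> C" "\<And>y y'. 0 \<le> y \<Longrightarrow> y < 1 \<Longrightarrow> 0 \<le> y' \<Longrightarrow> y' < 1 \<Longrightarrow>
        \<bar>y - y'\<bar> \<le> C * \<bar>cell_point y - cell_point y'\<bar> powr (s / 2)"
      using cell_point_inverse_Holder[of "s / 2"] s by auto
    show ?thesis
    proof (rule hausdorff_measure_nonzero_if_inverse_Holder)
      fix p :: "real \<times> real" assume "p \<in> box (0, 0) (1, 1)"
      then obtain y z where p: "p = (y, z)" and z: "0 < z" "z < 1"
        by (cases p) (auto simp: box_prod)
      have "grid \<alpha> (cell_point y) (z / 3) \<inter> S_plus window = {}"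
      proof (rule ccontr)
        assume "grid \<alpha> (cell_point y) (z / 3) \<inter> S_plus window \<noteq> {}"
        then obtain v where v: "v \<in> grid \<alpha> (cell_point y) (z / 3)" "v \<in> S_plus window" by blast
        have "1 / 72 \<le> \<bar>v $ 1\<bar> * v $ 2"
          using \<alpha> cell_point z v S_plus_window[OF v(2)]
          by (intro grid_badly_approximable[where c = "cell y" and a = "cell_point y" and b = "z / 3"]) auto
        then show False using S_plus_window(2)[OF v(2)] by simp
      qed
      then show "\<phi> p \<in> F"
        by (simp add: \<phi>_def p F_def x_def finite_grids_def grid_in_grids)
    next
      fix p p' :: "real \<times> real"
      assume "p \<in> box (0, 0) (1, 1)" "p' \<in> box (0, 0) (1, 1)"
      then obtain y z y' z' where p: "p = (y, z)" "p' = (y', z')" and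
        y: "0 < y" "y < 1" "0 < y'" "y' < 1" and z: "0 < z" "z < 1" "0 < z'" "z' < 1"
        by (cases p; cases p') (auto simp: box_prod)
      define d where "d = setdist (\<phi> p) (\<phi> p')"
      have "1 / 3 \<le> cell_point u" "cell_point u \<le> 2 / 3" for u
        using cell_point[where k = 0 and y = u] by simp_all
      from this[of y] this[of y'] have "\<bar>cell_point y - cell_point y'\<bar> \<le> 1 / 3" by linarith
      moreover have "\<bar>z / 3 - z' / 3\<bar> \<le> 1 / 3" using z by linarith
      ultimately have d: "\<bar>cell_point y - cell_point y'\<bar> \<le> d" "\<bar>z / 3 - z' / 3\<bar> \<le> d"
        using setdist_grid_ge unfolding d_def \<phi>_def p by auto
      have "\<bar>y - y'\<bar> \<le> C * \<bar>cell_point y - cell_point y'\<bar> powr (s / 2)" using C y by simp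
      also have "\<dots> \<le> C * d powr (s / 2)"
        using C(1) d(1) s by (intro mult_left_mono powr_mono2) auto
      finally have 1: "\<bar>y - y'\<bar> \<le> C * d powr (s / 2)" .
      have "\<bar>z - z'\<bar> = \<bar>z - z'\<bar> powr 1" by simp
      also have "\<dots> \<le> \<bar>z - z'\<bar> powr (s / 2)"
        using z s by (intro powr_mono') auto
      also have "\<dots> \<le> (3 * d) powr (s / 2)" using d(2) s by (intro powr_mono2) auto
      also have "\<dots> \<le> 3 * d powr (s / 2)"
        using s powr_mono[of "s / 2" 1 "3 :: real"] setdist_pos_le[of "\<phi> p" "\<phi> p'"]
        by (simp add: powr_mult d_def mult_right_mono)
      finally have 2: "\<bar>z - z'\<bar> \<le> 3 * d powr (s / 2)" .
      have "dist p p' \<le> \<bar>y - y'\<bar> + \<bar>z - z'\<bar>"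
        unfolding p dist_Pair_Pair dist_real_def
        using sqrt_sum_squares_le_sum_abs[of "\<bar>y - y'\<bar>" "\<bar>z - z'\<bar>"] by simp
      then show "dist p p' \<le> (C + 3) * setdist (\<phi> p) (\<phi> p') powr (s / 2)"
        using 1 2 by (simp add: d_def distrib_right)
    qed (use s C in auto)
  qed
  ultimately have "hausdorff_dim (grids x) setdist F = ereal 2"
    by (intro hausdorff_dim_eqI) auto
  then have "hausdorff_dim (grids x) setdist F = 2" by simp
  moreover have "nonsingular_lattice x"
    unfolding x_def using \<alpha> by (rule nonsingular_lattice_of_convergents)
  ultimately show ?thesis
    using open_window bounded_window window_nonempty unfolding F_def by blast
qed

end
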